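(* Let $n$ be odd. The 3D pentagram map $T$ on the space $\mathcal{P}_n$ of twisted $n$-gons in $\mathbb{CP}^3$ admits a discrete zero-curvature representation with spectral parameter $\lambda\in\mathbb{C}$, with Lax function $$L_{j,t}(\lambda)=\begin{pmatrix} c_j/\lambda & 1/\lambda & 0 & 0\\ b_j & 0 & 1 & 0\\ a_j/\lambda & 0 & 0 & 1/\lambda\\ -1 & 0 & 0 & 0\end{pmatrix}=\begin{pmatrix} 0&0&0&-1\\ \lambda&0&0&c_j\\ 0&1&0&b_j\\ 0&0&\lambda&a_j\end{pmatrix}^{-1},$$ where $a_j,b_j,c_j$ ($j\in\mathbb{Z}$, $n$-periodic in $j$) are the coordinates of the polygon at time $t$, i.e. of the $t$-th iterate under $T$ of the initial polygon. That is, there exists an appropriate invertible $4\times4$ matrix function $P_{j,t}(\lambda)$, $n$-periodic in $j$, such that for all $j$ and $t$ $$L_{j,t+1}(\lambda)=P_{j+1,t}(\lambda)\,L_{j,t}(\lambda)\,P_{j,t}^{-1}(\lambda)$$ along the dynamics of the pentagram map (wherever the iterates are defined).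
   Context: A twisted $n$-gon in $\mathbb{CP}^3$ with monodromy $M\in SL_4(\mathbb{C})$ is a map $\phi:\mathbb{Z}\to\mathbb{CP}^3$ with $\phi(k+n)=M\circ\phi(k)$ for all $k\in\mathbb{Z}$ (the matrix $M$ is part of the data). Two twisted $n$-gons are equivalent if $\phi_2=g\circ\phi_1$ for some $g\in SL_4(\mathbb{C})$ (monodromies being conjugated by $g$). Vertices are assumed to be in general position; in particular no 4 consecutive vertices lie in one plane. $\mathcal{P}_n$ is the space of equivalence classes. 3D pentagram map $T$: for each $k$ let $P_k$ be the plane through $\phi(k-2),\phi(k),\phi(k+2)$; the image of the vertex $\phi(k)$ is the point $P_{k-1}\cap P_k\cap P_{k+1}$. The image polygon has the same monodromy, and $T$ is generically defined on $\mathcal{P}_n$. Coordinates for odd $n$: the vertices $\phi(k)$ lift to vectors $V_k\in\mathbb{C}^4$ with $\det(V_j,V_{j+1},V_{j+2},V_{j+3})=1$ and $V_{j+n}=MV_j$ for all $j$ (unique up to a common scalar factor, which does not affect what follows). They satisfy $V_{j+4}=a_jV_{j+3}+b_jV_{j+2}+c_jV_{j+1}-V_j$, $j\in\mathbb{Z}$, with $n$-periodic sequences $a_j,b_j,c_j$. The $3n$ numbers $(a_j,b_j,c_j)$, $0\le j\le n-1$, are the coordinates on $\mathcal{P}_n$. *)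

theory Defs
  imports "HOL-Analysis.Analysis"
begin

lemma vector_4 [simp]:
  "(vector [w, x, y, z] :: 'a::zero^4) $ 1 = w"
  "(vector [w, x, y, z] :: 'a::zero^4) $ 2 = x"
  "(vector [w, x, y, z] :: 'a::zero^4) $ 3 = y"
  "(vector [w, x, y, z] :: 'a::zero^4) $ 4 = z"
  unfolding vector_def by simp_all

text \<open>
  Points and planes of complex projective 3-space are the complex linear subspaces of
  \<open>\<complex>\<^sup>4\<close> of dimension 1 and 3; incidence is inclusion, and intersections are
  intersections of subspaces. Note that \<^const>\<open>vec.subspace\<close>, \<^const>\<open>vec.span\<close> and
  \<^const>\<open>vec.dim\<close> are taken over the field of scalars, here the complex numbers.
\<close>

definition CP3 :: "(complex^4) set set" where
  "CP3 = {S. vec.subspace S \<and> vec.dim S = 1}"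

definition CP3_planes :: "(complex^4) set set" where
  "CP3_planes = {S. vec.subspace S \<and> vec.dim S = 3}"

definition in_general_position :: "(int \<Rightarrow> (complex^4) set) \<Rightarrow> bool" where
  "in_general_position \<phi> \<longleftrightarrow>
     (\<forall>k. \<not> (\<exists>H\<in>CP3_planes. \<phi> k \<subseteq> H \<and> \<phi> (k+1) \<subseteq> H \<and> \<phi> (k+2) \<subseteq> H \<and> \<phi> (k+3) \<subseteq> H))"

definition twisted_polygon :: "nat \<Rightarrow> complex^4^4 \<Rightarrow> (int \<Rightarrow> (complex^4) set) \<Rightarrow> bool" where
  "twisted_polygon n M \<phi> \<longleftrightarrow>
     det M = 1 \<and> (\<forall>k. \<phi> k \<in> CP3) \<and> (\<forall>k. \<phi> (k + int n) = (\<lambda>v. M *v v) ` \<phi> k) \<and>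
     in_general_position \<phi>"

definition pentagram_plane :: "(int \<Rightarrow> (complex^4) set) \<Rightarrow> int \<Rightarrow> (complex^4) set" where
  "pentagram_plane \<phi> k = vec.span (\<phi> (k-2) \<union> \<phi> k \<union> \<phi> (k+2))"

definition pentagram :: "(int \<Rightarrow> (complex^4) set) \<Rightarrow> int \<Rightarrow> (complex^4) set" where
  "pentagram \<phi> k = pentagram_plane \<phi> (k-1) \<inter> pentagram_plane \<phi> k \<inter> pentagram_plane \<phi> (k+1)"

text \<open>
  The map is only generically defined: the three vertices must span a plane, the three planes must
  meet in exactly one point, and the image must again be in general position.
\<close>

definition pentagram_defined :: "(int \<Rightarrow> (complex^4) set) \<Rightarrow> bool" where
  "pentagram_defined \<phi> \<longleftrightarrow>
     (\<forall>k. pentagram_plane \<phi> k \<in> CP3_planes) \<and> (\<forall>k. pentagram \<phi> k \<in> CP3) \<and>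
     in_general_position (pentagram \<phi>)"

definition pentagram_iterate_defined :: "nat \<Rightarrow> (int \<Rightarrow> (complex^4) set) \<Rightarrow> bool" where
  "pentagram_iterate_defined t \<phi> \<longleftrightarrow> (\<forall>s<t. pentagram_defined ((pentagram ^^ s) \<phi>))"

definition normalized_lift ::
    "nat \<Rightarrow> complex^4^4 \<Rightarrow> (int \<Rightarrow> (complex^4) set) \<Rightarrow> (int \<Rightarrow> complex^4) \<Rightarrow> bool" where
  "normalized_lift n M \<phi> V \<longleftrightarrow>
     (\<forall>j. vec.span {V j} = \<phi> j) \<and>
     (\<forall>j. det (vector [V j, V (j+1), V (j+2), V (j+3)] :: complex^4^4) = 1) \<and>
     (\<forall>j. V (j + int n) = M *v V j)"

definition are_coordinates ::
    "nat \<Rightarrow> complex^4^4 \<Rightarrow> (int \<Rightarrow> (complex^4) set) \<Rightarrow>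
     (int \<Rightarrow> complex) \<Rightarrow> (int \<Rightarrow> complex) \<Rightarrow> (int \<Rightarrow> complex) \<Rightarrow> bool" where
  "are_coordinates n M \<phi> a b c \<longleftrightarrow>
     (\<forall>j. a (j + int n) = a j \<and> b (j + int n) = b j \<and> c (j + int n) = c j) \<and>
     (\<exists>V. normalized_lift n M \<phi> V \<and>
        (\<forall>j. V (j+4) = a j *s V (j+3) + b j *s V (j+2) + c j *s V (j+1) - V j))"

text \<open>
  For odd \<open>n\<close> the coordinates of a twisted polygon exist and are unique: a normalized lift exists
  and any two differ by a constant scalar factor.
\<close>

definition coordinates ::
    "nat \<Rightarrow> complex^4^4 \<Rightarrow> (int \<Rightarrow> (complex^4) set) \<Rightarrow>
     (int \<Rightarrow> complex) \<times> (int \<Rightarrow> complex) \<times> (int \<Rightarrow> complex)" where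
  "coordinates n M \<phi> = (THE (a, b, c). are_coordinates n M \<phi> a b c)"

definition coord_a :: "nat \<Rightarrow> complex^4^4 \<Rightarrow> (int \<Rightarrow> (complex^4) set) \<Rightarrow> int \<Rightarrow> complex" where
  "coord_a n M \<phi> = fst (coordinates n M \<phi>)"

definition coord_b :: "nat \<Rightarrow> complex^4^4 \<Rightarrow> (int \<Rightarrow> (complex^4) set) \<Rightarrow> int \<Rightarrow> complex" where
  "coord_b n M \<phi> = fst (snd (coordinates n M \<phi>))"

definition coord_c :: "nat \<Rightarrow> complex^4^4 \<Rightarrow> (int \<Rightarrow> (complex^4) set) \<Rightarrow> int \<Rightarrow> complex" where
  "coord_c n M \<phi> = snd (snd (coordinates n M \<phi>))"

definition lax_matrix :: "complex \<Rightarrow> complex \<Rightarrow> complex \<Rightarrow> complex \<Rightarrow> complex^4^4" where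
  "lax_matrix a b c z = vector
     [vector [c / z, 1 / z, 0, 0],
      vector [b,     0,     1, 0],
      vector [a / z, 0,     0, 1 / z],
      vector [-1,    0,     0, 0]]"

definition lax_inverse_matrix :: "complex \<Rightarrow> complex \<Rightarrow> complex \<Rightarrow> complex \<Rightarrow> complex^4^4" where
  "lax_inverse_matrix a b c z = vector
     [vector [0, 0, 0, -1],
      vector [z, 0, 0, c],
      vector [0, 1, 0, b],
      vector [0, 0, z, a]]"

definition lax :: "nat \<Rightarrow> complex^4^4 \<Rightarrow> (int \<Rightarrow> (complex^4) set) \<Rightarrow> int \<Rightarrow> nat \<Rightarrow> complex \<Rightarrow> complex^4^4"
  where
  "lax n M \<phi> j t =
     (let \<psi> = (pentagram ^^ t) \<phi>
      in lax_matrix (coord_a n M \<psi> j) (coord_b n M \<psi> j) (coord_c n M \<psi> j))"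

end

theory Submission
  imports Defs
begin

text \<open>
  Let \<open>V\<close> be the normalized lift of a polygon. By the recurrence,
  \<open>W\<^sub>k = a\<^sub>k\<^sub>-\<^sub>2 V\<^sub>k\<^sub>+\<^sub>1 + c\<^sub>k\<^sub>-\<^sub>2 V\<^sub>k\<^sub>-\<^sub>1 = V\<^sub>k\<^sub>+\<^sub>2 - b\<^sub>k\<^sub>-\<^sub>2 V\<^sub>k + V\<^sub>k\<^sub>-\<^sub>2\<close> lies in the planes \<open>P\<^sub>k\<^sub>-\<^sub>1\<close>, \<open>P\<^sub>k\<close>
  and \<open>P\<^sub>k\<^sub>+\<^sub>1\<close>, so it spans the image vertex, and the normalized lift of the image is \<open>r\<^sub>k W\<^sub>k\<close> with \<open>r\<close>
  periodic. The transition matrices between the frames of four consecutive vectors of the two lifts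
  give the zero-curvature equation at \<open>\<lambda> = 1\<close>. The construction is homogeneous under the scaling
  \<open>(a, b, c) \<mapsto> (sa, b, sc)\<close>, which inserts the parameter \<open>\<lambda> = s\<^sup>-\<^sup>2\<close>; the determinant of the
  resulting gauge matrix is \<open>\<lambda>\<^sup>-\<^sup>2\<close> times its value at \<open>\<lambda> = 1\<close>, so it is invertible for
  all \<open>\<lambda> \<noteq> 0\<close>.
\<close>

section \<open>Linear algebra\<close>

text \<open>Expansion along the first row, which turns determinant statements about frames into
  polynomial identities in the entries.\<close>

lemma det_4:
  "det (A :: 'a::comm_ring_1^4^4) =
     A$1$1 * (A$2$2 * (A$3$3 * A$4$4 - A$3$4 * A$4$3) - A$2$3 * (A$3$2 * A$4$4 - A$3$4 * A$4$2)
              + A$2$4 * (A$3$2 * A$4$3 - A$3$3 * A$4$2))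
   - A$1$2 * (A$2$1 * (A$3$3 * A$4$4 - A$3$4 * A$4$3) - A$2$3 * (A$3$1 * A$4$4 - A$3$4 * A$4$1)
              + A$2$4 * (A$3$1 * A$4$3 - A$3$3 * A$4$1))
   + A$1$3 * (A$2$1 * (A$3$2 * A$4$4 - A$3$4 * A$4$2) - A$2$2 * (A$3$1 * A$4$4 - A$3$4 * A$4$1)
              + A$2$4 * (A$3$1 * A$4$2 - A$3$2 * A$4$1))
   - A$1$4 * (A$2$1 * (A$3$2 * A$4$3 - A$3$3 * A$4$2) - A$2$2 * (A$3$1 * A$4$3 - A$3$3 * A$4$1)
              + A$2$3 * (A$3$1 * A$4$2 - A$3$2 * A$4$1))"
proof -
  have f1234: "finite {2::4, 3, 4}" "1 \<notin> {2::4, 3, 4}"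
    and f234: "finite {3::4, 4}" "2 \<notin> {3::4, 4}"
    and f34: "finite {4::4}" "3 \<notin> {4::4}"
    by auto
  show ?thesis
    unfolding det_def UNIV_4
    unfolding sum_over_permutations_insert[OF f1234]
    unfolding sum_over_permutations_insert[OF f234]
    unfolding sum_over_permutations_insert[OF f34]
    unfolding permutes_sing
    apply (simp add: sign_swap_id sign_id permutation_swap_id permutation_compose sign_compose transpose_eq_iff swap_id_eq)
    by (simp add: algebra_simps)
qed

text \<open>\<open>matrix_inv\<close> chooses a two-sided inverse; over a field a right inverse of a
  square matrix is already two-sided, so the choice is forced.\<close>

lemma matrix_inv_eqI:
  fixes A B :: "'a::field^'n^'n"
  assumes "A ** B = mat 1"
  shows "matrix_inv A = B"
proof -
  have BA: "B ** A = mat 1"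
    using assms matrix_left_right_inverse by blast
  have "A ** matrix_inv A = mat 1 \<and> matrix_inv A ** A = mat 1"
    unfolding matrix_inv_def by (rule someI[of _ B]) (use assms BA in auto)
  then show ?thesis
    by (metis BA matrix_mul_assoc matrix_mul_lid matrix_mul_rid)
qed

lemma matrix_inv_invertible:
  fixes A :: "'a::field^'n^'n"
  assumes "invertible A"
  shows "A ** matrix_inv A = mat 1" "matrix_inv A ** A = mat 1"
    "invertible (matrix_inv A)" "matrix_inv (matrix_inv A) = A"
proof -
  obtain B where B: "A ** B = mat 1" "B ** A = mat 1"
    using assms invertible_def by blast
  then have "matrix_inv A = B" "matrix_inv B = A"
    by (auto intro: matrix_inv_eqI)
  then show "A ** matrix_inv A = mat 1" "matrix_inv A ** A = mat 1"
    "invertible (matrix_inv A)" "matrix_inv (matrix_inv A) = A"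
    using B by (auto simp: invertible_def)
qed

lemma lax_inverse_mult_lax:
  assumes "z \<noteq> 0"
  shows "lax_inverse_matrix a b c z ** lax_matrix a b c z = mat 1"
  using assms
  by (simp add: lax_inverse_matrix_def lax_matrix_def matrix_matrix_mult_def mat_def vec_eq_iff
      forall_4 sum_4)

section \<open>Points and planes of projective space\<close>

text \<open>A coordinate vector on which the linear form is nonzero spans the whole space together
  with the kernel, so the kernel has codimension one.\<close>

lemma dim_hyperplane:
  fixes x :: "'a::field^'n"
  assumes "x \<noteq> 0"
  shows "vec.subspace {v. (\<Sum>i\<in>UNIV. v $ i * x $ i) = 0}"
    and "vec.dim {v. (\<Sum>i\<in>UNIV. v $ i * x $ i) = 0} = CARD('n) - 1"
proof -
  define f where "f v = (\<Sum>i\<in>UNIV. v $ i * x $ i)" for v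
  define H where "H = {v. f v = 0}"
  have f_add: "f (u + v) = f u + f v" and f_diff: "f (u - v) = f u - f v" for u v
    by (simp_all add: f_def algebra_simps sum.distrib sum_subtractf)
  have f_scale: "f (k *s v) = k * f v" for k v
    by (simp add: f_def sum_distrib_left mult.assoc)
  have f_0: "f 0 = 0"
    by (simp add: f_def)
  have sub: "vec.subspace H"
    unfolding vec.subspace_def H_def mem_Collect_eq f_add f_scale f_0 by simp
  obtain i where i: "x $ i \<noteq> 0"
    using assms by (metis vec_eq_iff zero_index)
  have "f (axis i 1) = (\<Sum>k\<in>UNIV. if k = i then x $ k else 0)"
    unfolding f_def by (rule sum.cong) (auto simp: axis_def)
  then have fy: "f (axis i 1) \<noteq> 0"
    using i by simp
  have "v \<in> vec.span (insert (axis i 1) H)" for v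
  proof -
    have "v - (f v / f (axis i 1)) *s axis i 1 \<in> H"
      using fy by (simp add: H_def f_diff f_scale)
    then show ?thesis
      unfolding vec.span_breakdown_eq by (blast intro: vec.span_base)
  qed
  then have "vec.span (insert (axis i 1) H) = UNIV"
    by auto
  then have "vec.dim (insert (axis i 1) H) = CARD('n)"
    by (metis vec.dim_span vec_dim_card)
  moreover have "axis i 1 \<notin> vec.span H"
    unfolding vec.span_eq_iff[THEN iffD2, OF sub] using fy by (simp add: H_def)
  ultimately have "vec.dim H = CARD('n) - 1"
    by (simp add: vec.dim_insert)
  with sub show "vec.subspace {v. (\<Sum>i\<in>UNIV. v $ i * x $ i) = 0}"
    "vec.dim {v. (\<Sum>i\<in>UNIV. v $ i * x $ i) = 0} = CARD('n) - 1"
    by (simp_all add: H_def f_def)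
qed

text \<open>A nonzero kernel vector of the singular frame is a linear form vanishing on the four
  vertices; its kernel would be a plane containing them.\<close>

lemma in_general_position_det:
  assumes gp: "in_general_position \<phi>" and V: "\<And>j. \<phi> j = vec.span {V j}"
  shows "det (vector [V j, V (j+1), V (j+2), V (j+3)] :: complex^4^4) \<noteq> 0"
proof
  let ?A = "vector [V j, V (j+1), V (j+2), V (j+3)] :: complex^4^4"
  assume "det ?A = 0"
  then have "\<not> invertible ?A"
    by (simp add: invertible_det_nz)
  then obtain x where x: "?A *v x = 0" "x \<noteq> 0"
    by (metis invertible_left_inverse matrix_left_invertible_ker)
  let ?H = "{v. (\<Sum>i\<in>UNIV. v $ i * x $ i) = 0}"
  have H: "vec.subspace ?H" "?H \<in> CP3_planes"
    using dim_hyperplane[OF x(2)] by (auto simp: CP3_planes_def)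
  have "V j \<in> ?H" "V (j+1) \<in> ?H" "V (j+2) \<in> ?H" "V (j+3) \<in> ?H"
    using x(1) by (simp_all add: vec_eq_iff forall_4 matrix_vector_mult_def)
  then have "\<phi> j \<subseteq> ?H" "\<phi> (j+1) \<subseteq> ?H" "\<phi> (j+2) \<subseteq> ?H" "\<phi> (j+3) \<subseteq> ?H"
    using H(1) by (simp_all add: V vec.span_minimal)
  then show False
    using gp H(2) unfolding in_general_position_def by blast
qed

lemma CP3_generator:
  assumes "S \<in> CP3"
  obtains v where "v \<noteq> 0" "S = vec.span {v}"
proof -
  have S: "vec.subspace S" "vec.dim S = 1"
    using assms by (auto simp: CP3_def)
  then obtain v where v: "v \<in> S" "v \<noteq> 0"
    by (metis vec.dim_eq_0 subsetI singletonD insert_iff zero_neq_one)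
  have "vec.span {v} = S"
    by (rule vec.subspace_dim_equal) (use S v in \<open>auto simp: vec.span_minimal\<close>)
  then show thesis using that v by blast
qed

lemma CP3_eq_span:
  assumes "S \<in> CP3" "v \<in> S" "v \<noteq> 0"
  shows "S = vec.span {v}"
proof -
  have "vec.span {v} = S"
    by (rule vec.subspace_dim_equal) (use assms in \<open>auto simp: CP3_def vec.span_minimal\<close>)
  then show ?thesis by simp
qed

section \<open>Normalized lifts and coordinates\<close>

lemma image_span_singleton:
  "(\<lambda>v. (M :: 'a::field^'n^'m) *v v) ` vec.span {x} = vec.span {M *v x}"
  by (auto simp: vec.span_singleton vec.scale image_iff)

lemma exists_twisted_lift:
  assumes n: "0 < n" and \<phi>: "twisted_polygon n M \<phi>"
  obtains V where "\<And>j. V j \<noteq> 0" "\<And>j. \<phi> j = vec.span {V j}" "\<And>j. V (j + int n) = M *v V j"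
proof -
  have shift: "\<phi> (k + int n) = (\<lambda>v. M *v v) ` \<phi> k" and CP3: "\<phi> k \<in> CP3" and "det M = 1" for k
    using \<phi> by (auto simp: twisted_polygon_def)
  then have inv: "invertible M"
    by (simp add: invertible_det_nz)
  have "\<exists>u. \<phi> j = vec.span {u}" for j
    using CP3_generator[OF CP3[of j]] by blast
  then obtain u where u: "\<And>j. \<phi> j = vec.span {u j}"
    by metis
  \<comment> \<open>\<open>p k\<close> is the \<open>k\<close>-th power of \<open>M\<close>, with
    negative exponents realised by the inverse.\<close>
  define p where "p k v = (if 0 \<le> k then (((*v) M) ^^ nat k) v
      else (((*v) (matrix_inv M)) ^^ nat (- k)) v)" for k :: int and v
  have p_Suc: "p (k + 1) v = M *v p k v" for k v
  proof (cases "0 \<le> k")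
    case True
    then have "nat (k + 1) = Suc (nat k)"
      by simp
    with True show ?thesis
      by (simp add: p_def)
  next
    case False
    define m where "m = nat (- (k + 1))"
    have m: "nat (- k) = Suc m"
      using False by (simp add: m_def)
    have "p (k + 1) v = (((*v) (matrix_inv M)) ^^ m) v"
      using False by (cases "k = -1") (simp_all add: p_def m_def)
    moreover have "p k v = matrix_inv M *v (((*v) (matrix_inv M)) ^^ m) v"
      using False m by (simp add: p_def)
    ultimately show ?thesis
      by (simp only: matrix_vector_mul_assoc matrix_inv_invertible(1)[OF inv] matrix_vector_mul_lid)
  qed
  have span_p: "\<phi> (j + k * int n) = vec.span {p k (u j)}" for j k
  proof (induction k rule: int_induct[of _ 0])
    case base
    then show ?case
      by (simp add: p_def u)
  next
    case (step1 i)
    have "\<phi> (j + (i + 1) * int n) = (\<lambda>v. M *v v) ` \<phi> (j + i * int n)"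
      by (metis shift distrib_right mult_1 add.assoc)
    then show ?case
      by (simp add: step1 image_span_singleton p_Suc)
  next
    case (step2 i)
    \<comment> \<open>Going down, the equality is known only after applying \<open>M\<close>;
      injectivity of \<open>M\<close> cancels it.\<close>
    have "(\<lambda>v. M *v v) ` \<phi> (j + (i - 1) * int n) = \<phi> (j + i * int n)"
      using shift[of "j + (i - 1) * int n"] by (simp add: algebra_simps)
    also have "\<dots> = (\<lambda>v. M *v v) ` vec.span {p (i - 1) (u j)}"
      using step2 p_Suc[of "i - 1"] by (simp add: image_span_singleton)
    finally show ?case
      using inj_image_eq_iff[OF inj_matrix_vector_mult[OF inv]] by blast
  qed
  \<comment> \<open>Generators are chosen on one period only and carried over by powers of
    \<open>M\<close>, so that the twist holds exactly and not just up to scalars.\<close>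
  define V where "V j = p (j div int n) (u (j mod int n))" for j
  show thesis
  proof (rule that)
    show V: "\<phi> j = vec.span {V j}" for j
      using span_p[of "j mod int n" "j div int n"] by (simp add: V_def)
    show "V (j + int n) = M *v V j" for j
      using n by (simp add: V_def p_Suc)
    show "V j \<noteq> 0" for j
      using CP3[of j] V[of j] by (auto simp: CP3_def)
  qed
qed

text \<open>Both existence and uniqueness of normalized lifts rest on 4 being invertible modulo an
  odd \<open>n\<close>: \<open>m = 3\<close> serves for \<open>n = 4 * i + 1\<close>, and
  \<open>m = 1\<close> for \<open>n = 4 * i + 3\<close>.\<close>

lemma exists_inverse_of_4:
  assumes "odd (n::nat)"
  obtains q m where "4 * q = n * m + 1"
proof -
  obtain k where k: "n = 2 * k + 1"
    using assms by (auto elim: oddE)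
  show thesis
  proof (cases "even k")
    case True
    then obtain i where "k = 2 * i" by (auto elim: evenE)
    then have "4 * (3 * i + 1) = n * 3 + 1" using k by simp
    then show thesis using that by blast
  next
    case False
    then obtain i where "k = 2 * i + 1" by (auto elim: oddE)
    then have "4 * (i + 1) = n * 1 + 1" using k by simp
    then show thesis using that by blast
  qed
qed

lemma periodic_mult:
  fixes f :: "int \<Rightarrow> 'a"
  assumes "\<And>j. f (j + p) = f j"
  shows "f (j + int m * p) = f j"
proof (induction m)
  case (Suc m)
  have "f (j + int (Suc m) * p) = f ((j + int m * p) + p)"
    by (simp add: algebra_simps)
  with Suc show ?case
    by (simp only: assms)
qed simp

lemma invariant_int:
  fixes f :: "int \<Rightarrow> 'a"
  assumes "\<And>j. f (j + 1) = f j"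
  shows "f j = f 0"
proof (induction j rule: int_induct[of _ 0])
  case (step2 i)
  then show ?case using assms[of "i - 1"] by simp
qed (simp_all add: assms)

lemma det_rows_scale_4:
  "det (vector [x0 *s v0, x1 *s v1, x2 *s v2, x3 *s v3] :: 'a::field^4^4) =
     x0 * x1 * x2 * x3 * det (vector [v0, v1, v2, v3])"
  unfolding det_4 vector_4 vector_smult_component by algebra

lemma det_rows_matrix_mult_4:
  fixes M :: "'a::field^4^4"
  shows "det (vector [M *v v0, M *v v1, M *v v2, M *v v3] :: 'a^4^4) =
    det M * det (vector [v0, v1, v2, v3] :: 'a^4^4)"
proof -
  have "(vector [M *v v0, M *v v1, M *v v2, M *v v3] :: 'a^4^4) =
      vector [v0, v1, v2, v3] ** transpose M"
    by (simp add: vec_eq_iff forall_4 matrix_matrix_mult_def transpose_def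
        matrix_vector_mult_def mult.commute)
  then show ?thesis
    by (simp add: det_mul)
qed

text \<open>
  The factors \<open>t\<close> must satisfy \<open>t\<^sub>j t\<^sub>j\<^sub>+\<^sub>1 t\<^sub>j\<^sub>+\<^sub>2 t\<^sub>j\<^sub>+\<^sub>3 = e\<^sub>j\<close>, hence \<open>t\<^sub>j\<^sub>+\<^sub>4 / t\<^sub>j = e\<^sub>j\<^sub>+\<^sub>1 / e\<^sub>j\<close>. Since
  \<open>4 q \<equiv> 1\<close> modulo \<open>n\<close>, the product of \<open>e\<^sub>j\<^sub>+\<^sub>4\<^sub>i\<close> over \<open>i < q\<close> telescopes to a solution of the latter, and
  it remains to adjust a constant by a fourth root.
\<close>

lemma exists_normalized_lift:
  assumes n: "odd n" and \<phi>: "twisted_polygon n M \<phi>"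
  obtains V where "normalized_lift n M \<phi> V"
proof -
  obtain v where v: "\<And>j. v j \<noteq> 0" "\<And>j. \<phi> j = vec.span {v j}" "\<And>j. v (j + int n) = M *v v j"
    using exists_twisted_lift[OF _ \<phi>] n odd_pos by blast
  have M: "det M = 1" and gp: "in_general_position \<phi>"
    using \<phi> by (auto simp: twisted_polygon_def)
  define d where "d j = det (vector [v j, v (j+1), v (j+2), v (j+3)] :: complex^4^4)" for j
  define e where "e j = inverse (d j)" for j
  have d0: "d j \<noteq> 0" for j
    unfolding d_def by (rule in_general_position_det[OF gp v(2)])
  have per_d: "d (j + int n) = d j" for j
  proof -
    have "v (j + int n + k) = M *v v (j + k)" for k
      using v(3)[of "j + k"] by (simp add: algebra_simps)
    then show ?thesis
      by (simp add: d_def v(3) det_rows_matrix_mult_4 M)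
  qed
  then have per_e: "e (j + int n) = e j" for j
    by (simp add: e_def)
  have e0: "e j \<noteq> 0" for j
    by (simp add: e_def d0)
  obtain q m where q: "4 * q = n * m + 1"
    using exists_inverse_of_4[OF n] by blast
  define t where "t j = (\<Prod>i<q. e (j + 4 * int i))" for j
  have t0: "t j \<noteq> 0" for j
    by (simp add: t_def e0)
  have per_t: "t (j + int n) = t j" for j
  proof -
    have "e (j + int n + 4 * int i) = e (j + 4 * int i)" for i
      using per_e[of "j + 4 * int i"] by (simp add: algebra_simps)
    then show ?thesis by (simp add: t_def)
  qed
  have t_step: "t (j + 4) * e j = t j * e (j + 1)" for j
  proof -
    \<comment> \<open>One product of \<open>q + 1\<close> factors, split at its first factor here
      and at its last factor below.\<close>
    have "t (j + 4) * e j = (\<Prod>i<Suc q. e (j + 4 * int i))"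
      unfolding t_def prod.lessThan_Suc_shift by (simp add: algebra_simps)
    also have "\<dots> = t j * e (j + 4 * int q)"
      by (simp add: t_def)
    also have "4 * int q = 1 + int m * int n"
      using q by (metis mult.commute add.commute of_nat_1 of_nat_add of_nat_mult of_nat_numeral)
    also have "e (j + (1 + int m * int n)) = e (j + 1)"
      using periodic_mult[of e "int n" "j + 1" m] per_e by (simp add: add.assoc)
    finally show ?thesis .
  qed
  \<comment> \<open>\<open>C j\<close> is the determinant of the frame rescaled by \<open>t\<close>;
    the relation \<open>t_step\<close> makes it independent of \<open>j\<close>.\<close>
  define C where "C j = t j * t (j+1) * t (j+2) * t (j+3) * d j" for j
  have C_step: "C (j + 1) = C j" for j
  proof -
    have "t (j + 4) * d (j + 1) = t j * d j"
      using t_step[of j] d0[of j] d0[of "j+1"] by (simp add: e_def field_simps)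
    then show ?thesis
      by (simp add: C_def add.assoc)
  qed
  have C: "C j = C 0" for j
    using invariant_int[of C j] C_step by blast
  have "C 0 \<noteq> 0"
    by (simp add: C_def t0 d0)
  define s where "s = csqrt (csqrt (inverse (C 0)))"
  have "s ^ 4 = (s\<^sup>2)\<^sup>2"
    by simp
  then have s: "s ^ 4 * C 0 = 1" "s \<noteq> 0"
    using \<open>C 0 \<noteq> 0\<close> by (auto simp: s_def)
  have "normalized_lift n M \<phi> (\<lambda>j. (s * t j) *s v j)"
    unfolding normalized_lift_def
  proof (intro conjI allI)
    fix j
    show "vec.span {(s * t j) *s v j} = \<phi> j"
      unfolding v(2) by (rule vec.span_image_scale[of "{v j}" "\<lambda>_. s * t j", simplified]) (use s t0 in auto)
    show "det (vector [(s * t j) *s v j, (s * t (j+1)) *s v (j+1), (s * t (j+2)) *s v (j+2),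
        (s * t (j+3)) *s v (j+3)] :: complex^4^4) = 1"
    proof -
      have "s * t j * (s * t (j+1)) * (s * t (j+2)) * (s * t (j+3)) * d j = s ^ 4 * C j"
        unfolding C_def by algebra
      then show ?thesis
        unfolding det_rows_scale_4 d_def[symmetric] using C[of j] s by simp
    qed
    show "(s * t (j + int n)) *s v (j + int n) = M *v ((s * t j) *s v j)"
      by (simp add: per_t v(3) vec.scale)
  qed
  then show thesis using that by blast
qed

text \<open>Combinations of a frame become a matrix applied to the coefficients, so their existence
  and uniqueness reduce to invertibility.\<close>

lemma frame_transpose_mult:
  fixes v0 v1 v2 v3 x :: "'a::field^4"
  shows "transpose (vector [v0, v1, v2, v3] :: 'a^4^4) *v x =
    x $ 1 *s v0 + x $ 2 *s v1 + x $ 3 *s v2 + x $ 4 *s v3"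
  unfolding vec_eq_iff matrix_vector_mult_def transpose_def sum_4
  by (simp add: mult.commute)

lemma frame_coefficients_unique:
  fixes v0 v1 v2 v3 :: "'a::field^4"
  assumes det: "det (vector [v0, v1, v2, v3] :: 'a^4^4) \<noteq> 0"
    and eq: "x0 *s v0 + x1 *s v1 + x2 *s v2 + x3 *s v3 = y0 *s v0 + y1 *s v1 + y2 *s v2 + y3 *s v3"
  shows "x0 = y0" "x1 = y1" "x2 = y2" "x3 = y3"
proof -
  let ?A = "transpose (vector [v0, v1, v2, v3] :: 'a^4^4)"
  have "invertible ?A"
    using det by (simp add: invertible_det_nz)
  moreover have "?A *v vector [x0, x1, x2, x3] = ?A *v vector [y0, y1, y2, y3]"
    unfolding frame_transpose_mult vector_4 by (rule eq)
  ultimately have "(vector [x0, x1, x2, x3] :: 'a^4) = vector [y0, y1, y2, y3]"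
    by (rule inj_matrix_vector_mult[THEN injD])
  then show "x0 = y0" "x1 = y1" "x2 = y2" "x3 = y3"
    by (simp_all add: vec_eq_iff forall_4)
qed

lemma frame_coefficients_exist:
  fixes v0 v1 v2 v3 w :: "'a::field^4"
  assumes det: "det (vector [v0, v1, v2, v3] :: 'a^4^4) \<noteq> 0"
  obtains x0 x1 x2 x3 where "w = x0 *s v0 + x1 *s v1 + x2 *s v2 + x3 *s v3"
proof -
  let ?A = "transpose (vector [v0, v1, v2, v3] :: 'a^4^4)"
  obtain B where B: "?A ** B = mat 1"
    using det invertible_det_nz[of ?A] by (auto simp: invertible_def)
  have "?A *v (B *v w) = w"
    by (simp only: matrix_vector_mul_assoc B matrix_vector_mul_lid)
  then show thesis
    unfolding frame_transpose_mult by (rule that[OF sym])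
qed

text \<open>Expanding \<open>V (j+4)\<close> in the frame at \<open>j\<close>, equality of
  consecutive determinants fixes the coefficient of \<open>V j\<close>. Periodicity follows by
  cancelling \<open>M\<close> and using uniqueness of coefficients.\<close>

lemma normalized_lift_recurrence:
  assumes V: "normalized_lift n M \<phi> V"
  obtains a b c where "are_coordinates n M \<phi> a b c"
    "\<And>j. V (j+4) = a j *s V (j+3) + b j *s V (j+2) + c j *s V (j+1) - V j"
proof -
  have det: "det (vector [V j, V (j+1), V (j+2), V (j+3)] :: complex^4^4) = 1"
    and per: "V (j + int n) = M *v V j" for j
    using V by (auto simp: normalized_lift_def)
  then have det0: "det (vector [V j, V (j+1), V (j+2), V (j+3)] :: complex^4^4) \<noteq> 0" for j
    by simp
  have "\<exists>a b c. V (j+4) = a *s V (j+3) + b *s V (j+2) + c *s V (j+1) - V j" for j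
  proof -
    obtain x0 x1 x2 x3 where
      x: "V (j+4) = x0 *s V j + x1 *s V (j+1) + x2 *s V (j+2) + x3 *s V (j+3)"
      using frame_coefficients_exist[OF det0] by blast
    have "1 = det (vector [V (j+1), V (j+2), V (j+3), V (j+4)] :: complex^4^4)"
      using det[of "j+1"] by (simp add: add.assoc)
    \<comment> \<open>Only the \<open>V j\<close> term of \<open>V (j+4)\<close> survives, and the
      cyclic shift of four rows is an odd permutation.\<close>
    also have "\<dots> = - x0 * det (vector [V j, V (j+1), V (j+2), V (j+3)] :: complex^4^4)"
      unfolding det_4 vector_4 x vector_add_component vector_smult_component by algebra
    finally have "x0 = - 1"
      unfolding det by (simp add: eq_neg_iff_add_eq_0 add.commute)
    then show ?thesis
      using x by (intro exI[of _ x3] exI[of _ x2] exI[of _ x1]) (simp add: vec_eq_iff)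
  qed
  then obtain a b c where
    rec: "\<And>j. V (j+4) = a j *s V (j+3) + b j *s V (j+2) + c j *s V (j+1) - V j"
    by metis
  have "a (j + int n) = a j \<and> b (j + int n) = b j \<and> c (j + int n) = c j" for j
  proof -
    have per': "V (j + int n + k) = M *v V (j + k)" for k
      using per[of "j + k"] by (simp add: algebra_simps)
    \<comment> \<open>The frames at \<open>j\<close> and \<open>j + n\<close> both have determinant
      1 and differ by \<open>M\<close>.\<close>
    have "det M = 1"
      using det[of j] det[of "j + int n"] by (simp add: per per' det_rows_matrix_mult_4)
    then have inv: "invertible M"
      by (simp add: invertible_det_nz)
    have "M *v V (j+4) = M *v (a (j + int n) *s V (j+3) + b (j + int n) *s V (j+2)
        + c (j + int n) *s V (j+1) - V j)"
      using rec[of "j + int n"] 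
      by (simp add: per per' vec.add vec.diff vec.scale)
    then have "V (j+4) = a (j + int n) *s V (j+3) + b (j + int n) *s V (j+2)
        + c (j + int n) *s V (j+1) - V j"
      by (rule inj_matrix_vector_mult[OF inv, THEN injD])
    with rec[of j] have "0 *s V j + c (j + int n) *s V (j+1) + b (j + int n) *s V (j+2)
        + a (j + int n) *s V (j+3) = 0 *s V j + c j *s V (j+1) + b j *s V (j+2) + a j *s V (j+3)"
      by (simp add: algebra_simps)
    from frame_coefficients_unique[OF det0 this] show ?thesis
      by simp
  qed
  then have "are_coordinates n M \<phi> a b c"
    unfolding are_coordinates_def using V rec by blast
  with rec show thesis
    using that by blast
qed

text \<open>The ratio \<open>u\<close> of two lifts has product 1 over any four consecutive indices,
  hence period 4. The common twist gives it period \<open>n\<close> as well, and coprime periods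
  make it constant.\<close>

lemma normalized_lift_unique:
  assumes n: "odd n" and V: "normalized_lift n M \<phi> V" and V': "normalized_lift n M \<phi> V'"
  obtains u where "u \<noteq> 0" "\<And>j. V' j = u *s V j"
proof -
  have det: "det (vector [V j, V (j+1), V (j+2), V (j+3)] :: complex^4^4) = 1"
    and det': "det (vector [V' j, V' (j+1), V' (j+2), V' (j+3)] :: complex^4^4) = 1"
    and per: "V (j + int n) = M *v V j" "V' (j + int n) = M *v V' j"
    and span: "vec.span {V j} = vec.span {V' j}" for j
    using V V' by (auto simp: normalized_lift_def)
  have "V' j \<in> vec.span {V j}" for j
    unfolding span by (simp add: vec.span_base)
  then have "\<exists>u. V' j = u *s V j" for j
    by (auto simp: vec.span_singleton)
  then obtain u where u: "\<And>j. V' j = u j *s V j"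
    by metis
  have prod: "u j * u (j+1) * u (j+2) * u (j+3) = 1" for j
    using det'[of j] unfolding u det_rows_scale_4 det by simp
  have u0: "u j \<noteq> 0" for j
    using prod[of j] by auto
  have V0: "V j \<noteq> 0" for j
  proof
    assume "V j = 0"
    then have "row 1 (vector [V j, V (j+1), V (j+2), V (j+3)] :: complex^4^4) = 0"
      by (simp add: row_def vec_eq_iff)
    then show False
      using det_zero_row(1) det[of j] by (metis zero_neq_one)
  qed
  have u4: "u (j + 4) = u j" for j
  proof -
    have "u (j+1) * u (j+2) * u (j+3) * u (j+4) = u j * u (j+1) * u (j+2) * u (j+3)"
      using prod[of "j+1"] prod[of j] by (simp add: add.assoc)
    then have "(u (j+1) * u (j+2) * u (j+3)) * u (j+4) = (u (j+1) * u (j+2) * u (j+3)) * u j"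
      by (simp only: ac_simps)
    then show ?thesis
      by (simp add: u0)
  qed
  have un: "u (j + int n) = u j" for j
  proof -
    have "u (j + int n) *s (M *v V j) = u j *s (M *v V j)"
      using per(2)[of j] by (simp add: u per(1) vec.scale)
    moreover have "M *v V j \<noteq> 0"
      using V0[of "j + int n"] by (simp add: per(1))
    ultimately show ?thesis
      by (simp add: vec.scale_right_imp_eq)
  qed
  obtain q m where q: "4 * q = n * m + 1"
    using exists_inverse_of_4[OF n] by blast
  have "u (j + 1) = u j" for j
  proof -
    \<comment> \<open>A step of 1 plus \<open>m\<close> periods of length \<open>n\<close> equals
      \<open>q\<close> periods of length 4.\<close>
    have "u (j + 1) = u (j + 1 + int m * int n)"
      using periodic_mult[of u "int n"] un by simp
    also have "j + 1 + int m * int n = j + int q * 4"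
      using arg_cong[OF q, of int] by (simp add: algebra_simps)
    also have "u (j + int q * 4) = u j"
      using periodic_mult[of u 4] u4 by simp
    finally show ?thesis .
  qed
  then have "u j = u 0" for j
    by (rule invariant_int)
  then show thesis
    using that[of "u 0"] u u0 by metis
qed

text \<open>The constant ratio of two normalized lifts cancels from the recurrence, so the definite
  description picks out any coordinates that are exhibited.\<close>

lemma coordinates_eqI:
  assumes n: "odd n" and abc: "are_coordinates n M \<phi> a b c"
  shows "coordinates n M \<phi> = (a, b, c)"
proof -
  have unique: "a' = a \<and> b' = b \<and> c' = c" if abc': "are_coordinates n M \<phi> a' b' c'" for a' b' c'
  proof -
    obtain V where V: "normalized_lift n M \<phi> V"
      and rec: "\<And>j. V (j+4) = a j *s V (j+3) + b j *s V (j+2) + c j *s V (j+1) - V j"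
      using abc by (auto simp: are_coordinates_def)
    obtain V' where V': "normalized_lift n M \<phi> V'"
      and rec': "\<And>j. V' (j+4) = a' j *s V' (j+3) + b' j *s V' (j+2) + c' j *s V' (j+1) - V' j"
      using abc' by (auto simp: are_coordinates_def)
    obtain u where u: "u \<noteq> 0" "\<And>j. V' j = u *s V j"
      using normalized_lift_unique[OF n V V'] by blast
    have "a' j = a j \<and> b' j = b j \<and> c' j = c j" for j
    proof -
      have "u *s V (j+4) = u *s (a' j *s V (j+3) + b' j *s V (j+2) + c' j *s V (j+1) - V j)"
        using rec'[of j] by (simp add: u(2) vec_eq_iff algebra_simps)
      then have "V (j+4) = a' j *s V (j+3) + b' j *s V (j+2) + c' j *s V (j+1) - V j"
        using u(1) by (metis vec.scale_left_imp_eq)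
      with rec[of j] have eq: "0 *s V j + c' j *s V (j+1) + b' j *s V (j+2) + a' j *s V (j+3)
          = 0 *s V j + c j *s V (j+1) + b j *s V (j+2) + a j *s V (j+3)"
        by (simp add: algebra_simps)
      have "det (vector [V j, V (j+1), V (j+2), V (j+3)] :: complex^4^4) \<noteq> 0"
        using V by (simp add: normalized_lift_def)
      from frame_coefficients_unique[OF this eq] show ?thesis
        by simp
    qed
    then show ?thesis by auto
  qed
  show ?thesis
    unfolding coordinates_def
  proof (rule the_equality)
    show "case (a, b, c) of (a, b, c) \<Rightarrow> are_coordinates n M \<phi> a b c"
      using abc by simp
    show "p = (a, b, c)" if "case p of (a, b, c) \<Rightarrow> are_coordinates n M \<phi> a b c" for p
      using that unique by (cases p) auto
  qed
qed

section \<open>The pentagram map in coordinates\<close>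

lemma pentagram_plane_equivariant:
  assumes "\<And>k. \<phi> (k + int n) = (\<lambda>v. M *v v) ` \<phi> k"
  shows "pentagram_plane \<phi> (k + int n) = (\<lambda>v. M *v v) ` pentagram_plane \<phi> k"
proof -
  have "\<phi> (k + int n + i) = (\<lambda>v. M *v v) ` \<phi> (k + i)" for i
    using assms[of "k + i"] by (simp add: algebra_simps)
  from this[of "-2"] this[of 2] show ?thesis
    by (simp add: pentagram_plane_def assms vec.span_image flip: image_Un)
qed

text \<open>Linear maps commute with spans and injective ones also with intersections, so the
  construction preserves the monodromy.\<close>

lemma twisted_polygon_pentagram:
  assumes \<phi>: "twisted_polygon n M \<phi>" and T: "pentagram_defined \<phi>"
  shows "twisted_polygon n M (pentagram \<phi>)"
proof -
  have M: "det M = 1" and per: "\<phi> (k + int n) = (\<lambda>v. M *v v) ` \<phi> k" for k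
    using \<phi> by (auto simp: twisted_polygon_def)
  have "inj (\<lambda>v. M *v v)"
    using M by (intro inj_matrix_vector_mult) (simp add: invertible_det_nz)
  moreover have "pentagram_plane \<phi> (k + int n + i) = (\<lambda>v. M *v v) ` pentagram_plane \<phi> (k + i)" for k i
    using pentagram_plane_equivariant[of \<phi> n M "k + i"] per by (simp add: algebra_simps)
  note this[of _ "-1"] this[of _ 0] this[of _ 1]
  ultimately have "pentagram \<phi> (k + int n) = (\<lambda>v. M *v v) ` pentagram \<phi> k" for k
    by (simp add: pentagram_def image_Int)
  then show ?thesis
    using T M by (auto simp: twisted_polygon_def pentagram_defined_def)
qed

lemma twisted_polygon_iterate:
  assumes \<phi>: "twisted_polygon n M \<phi>"
  shows "pentagram_iterate_defined t \<phi> \<Longrightarrow> twisted_polygon n M ((pentagram ^^ t) \<phi>)"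
  by (induction t) (auto simp: \<phi> pentagram_iterate_defined_def intro: twisted_polygon_pentagram)

lemma pentagram_plane_lift:
  assumes "\<And>j. vec.span {V j} = \<phi> j"
  shows "pentagram_plane \<phi> k = vec.span {V (k-2), V k, V (k+2)}"
proof -
  have "pentagram_plane \<phi> k = vec.span (vec.span {V (k-2)} \<union> vec.span {V k} \<union> vec.span {V (k+2)})"
    by (simp add: pentagram_plane_def assms)
  also have "\<dots> = vec.span {V (k-2), V k, V (k+2)}"
  proof (rule subset_antisym)
    have "vec.span {V i} \<subseteq> vec.span {V (k-2), V k, V (k+2)}" if "i \<in> {k-2, k, k+2}" for i
      using that by (intro vec.span_mono) auto
    then show "vec.span (vec.span {V (k-2)} \<union> vec.span {V k} \<union> vec.span {V (k+2)})
        \<subseteq> vec.span {V (k-2), V k, V (k+2)}"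
      by (intro vec.span_minimal) simp_all
    have "{V (k-2), V k, V (k+2)} \<subseteq> vec.span {V (k-2)} \<union> vec.span {V k} \<union> vec.span {V (k+2)}"
      by (auto intro: vec.span_base)
    then show "vec.span {V (k-2), V k, V (k+2)}
        \<subseteq> vec.span (vec.span {V (k-2)} \<union> vec.span {V k} \<union> vec.span {V (k+2)})"
      by (rule vec.span_mono)
  qed
  finally show ?thesis .
qed

text \<open>The recurrence at \<open>k - 2\<close> separates parities: offsets -1 and 1 from
  \<open>k\<close> are shared by the planes at \<open>k - 1\<close> and \<open>k + 1\<close>, while
  offsets -2, 0 and 2 span the plane at \<open>k\<close>.\<close>

lemma pentagram_eq_span:
  assumes V: "\<And>j. vec.span {V j} = \<phi> j"
    and rec: "\<And>j. V (j+4) = a j *s V (j+3) + b j *s V (j+2) + c j *s V (j+1) - V j"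
    and T: "pentagram_defined \<phi>"
  defines "W \<equiv> \<lambda>k. a (k-2) *s V (k+1) + c (k-2) *s V (k-1)"
  shows "W k \<noteq> 0" and "pentagram \<phi> k = vec.span {W k}"
proof -
  note plane = pentagram_plane_lift[OF V]
  have W: "W k = V (k+2) + V (k-2) - b (k-2) *s V k"
    using rec[of "k-2"] by (simp add: W_def algebra_simps)
  \<comment> \<open>If \<open>W k\<close> vanished, the three vectors spanning the plane at
    \<open>k\<close> would be dependent.\<close>
  show W0: "W k \<noteq> 0"
  proof
    assume "W k = 0"
    then have "V (k+2) = b (k-2) *s V k - V (k-2)"
      by (simp add: W algebra_simps)
    moreover have "b (k-2) *s V k - V (k-2) \<in> vec.span {V (k-2), V k}"
      by (intro vec.span_diff vec.span_scale vec.span_base) simp_all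
    ultimately have "vec.span {V (k-2), V k, V (k+2)} \<subseteq> vec.span {V (k-2), V k}"
      by (intro vec.span_minimal) (simp_all add: vec.span_base)
    then have "vec.dim (vec.span {V (k-2), V k, V (k+2)}) \<le> vec.dim {V (k-2), V k}"
      by (metis vec.dim_span vec.dim_subset)
    also have "\<dots> \<le> card {V (k-2), V k}"
      by (rule vec.dim_le_card') simp
    also have "\<dots> \<le> 2"
      by (simp add: card_insert_if)
    finally show False
      using T by (auto simp: pentagram_defined_def plane CP3_planes_def)
  qed
  have "W k \<in> vec.span {V (k-3), V (k-1), V (k+1)}"
    "W k \<in> vec.span {V (k-1), V (k+1), V (k+3)}"
    unfolding W_def by (intro vec.span_add vec.span_scale vec.span_base; simp)+
  moreover have "W k \<in> vec.span {V (k-2), V k, V (k+2)}"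
    unfolding W by (intro vec.span_add vec.span_diff vec.span_scale vec.span_base) simp_all
  moreover have "k - 1 - 2 = k - 3" "k - 1 + 2 = k + 1" "k + 1 - 2 = k - 1" "k + 1 + 2 = k + 3"
    by simp_all
  ultimately have "W k \<in> pentagram \<phi> k"
    by (simp only: pentagram_def plane Int_iff)
  with T W0 show "pentagram \<phi> k = vec.span {W k}"
    by (intro CP3_eq_span) (auto simp: pentagram_defined_def)
qed

section \<open>The gauge matrix\<close>

text \<open>
  At \<open>\<mu> = 1\<close> the columns are the coordinates of \<open>r\<^sub>i (a\<^sub>i\<^sub>-\<^sub>2 V\<^sub>i\<^sub>+\<^sub>1 + c\<^sub>i\<^sub>-\<^sub>2 V\<^sub>i\<^sub>-\<^sub>1)\<close>, for
  \<open>i = j, \<dots>, j + 3\<close>, in the frame \<open>V\<^sub>j, \<dots>, V\<^sub>j\<^sub>+\<^sub>3\<close>. The powers of \<open>\<mu> = 1 / \<lambda>\<close> come from replacing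
  \<open>(a, b, c)\<close> by \<open>(sa, b, sc)\<close> with \<open>\<mu> = s\<^sup>2\<close>, conjugating by \<open>diag (1, s, 1, s)\<close>.
\<close>

definition gauge_inverse ::
    "complex \<Rightarrow> (int \<Rightarrow> complex) \<Rightarrow> (int \<Rightarrow> complex) \<Rightarrow> (int \<Rightarrow> complex) \<Rightarrow> (int \<Rightarrow> complex) \<Rightarrow> int
      \<Rightarrow> complex^4^4" where
  "gauge_inverse \<mu> a b c r j = vector
     [vector [\<mu> * c (j-2) * c (j-1) * r j, \<mu> * c (j-1) * r (j+1), 0, - \<mu> * a (j+1) * r (j+3)],
      vector [(a (j-2) + c (j-2) * b (j-1)) * r j, 0, c j * r (j+2), \<mu> * a (j+1) * c j * r (j+3)],
      vector [\<mu> * c (j-2) * a (j-1) * r j, \<mu> * a (j-1) * r (j+1), 0,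
              \<mu> * (c (j+1) + a (j+1) * b j) * r (j+3)],
      vector [- c (j-2) * r j, 0, a j * r (j+2), \<mu> * a (j+1) * a j * r (j+3)]]"

text \<open>The parameter enters only through the factor \<open>\<mu>\<^sup>2\<close>, so
  invertibility at \<mu> = 1 carries over to every nonzero \<mu>.\<close>

lemma det_gauge_inverse:
  "det (gauge_inverse \<mu> a b c r j) =
     \<mu>\<^sup>2 * r j * r (j+1) * r (j+2) * r (j+3) *
       (c (j-1) * (c (j+1) + a (j+1) * b j) + a (j-1) * a (j+1)) *
       (a j * (a (j-2) + c (j-2) * b (j-1)) + c (j-2) * c j)"
  unfolding det_4 gauge_inverse_def vector_4 by algebra

text \<open>At parameter 1 the inverse Lax matrix is the companion matrix of the recurrence; it is
  transposed because frames hold their vectors as rows.\<close>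

lemma frame_recurrence:
  assumes "\<And>j. V (j+4) = a j *s V (j+3) + b j *s V (j+2) + c j *s V (j+1) - V j"
  shows "(vector [V (j+1), V (j+2), V (j+3), V (j+4)] :: complex^4^4) =
    transpose (lax_inverse_matrix (a j) (b j) (c j) 1) ** vector [V j, V (j+1), V (j+2), V (j+3)]"
  by (simp add: assms lax_inverse_matrix_def matrix_matrix_mult_def transpose_def vec_eq_iff
      forall_4 sum_4 algebra_simps)

lemma frame_gauge_inverse:
  fixes V V' :: "int \<Rightarrow> complex^4"
  assumes V: "\<And>j. V (j+4) = a j *s V (j+3) + b j *s V (j+2) + c j *s V (j+1) - V j"
    and V': "\<And>j. V' j = r j *s (a (j-2) *s V (j+1) + c (j-2) *s V (j-1))"
  shows "(vector [V' j, V' (j+1), V' (j+2), V' (j+3)] :: complex^4^4) =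
    transpose (gauge_inverse 1 a b c r j) ** vector [V j, V (j+1), V (j+2), V (j+3)]"
proof -
  \<comment> \<open>\<open>V (j-1)\<close>, occurring in \<open>V' j\<close>, and
    \<open>V (j+4)\<close>, occurring in \<open>V' (j+3)\<close>, lie outside the frame at
    \<open>j\<close>; the recurrences at \<open>j - 1\<close> and \<open>j\<close> bring them
    back.\<close>
  have m1: "V (j-1) = a (j-1) *s V (j+2) + b (j-1) *s V (j+1) + c (j-1) *s V j - V (j+3)"
    using V[of "j-1"] by (simp add: algebra_simps)
  have *: "V' j = r j *s (a (j-2) *s V (j+1) + c (j-2) *s V (j-1))"
    "V' (j+1) = r (j+1) *s (a (j-1) *s V (j+2) + c (j-1) *s V j)"
    "V' (j+2) = r (j+2) *s (a j *s V (j+3) + c j *s V (j+1))"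
    "V' (j+3) = r (j+3) *s (a (j+1) *s V (j+4) + c (j+1) *s V (j+2))"
    using V'[of j] V'[of "j+1"] V'[of "j+2"] V'[of "j+3"] by (simp_all add: algebra_simps)
  show ?thesis
    unfolding * m1 V[of j]
    by (simp add: gauge_inverse_def matrix_matrix_mult_def transpose_def vec_eq_iff
        forall_4 sum_4 algebra_simps)
qed

text \<open>A commuting square: the frame of \<open>V'\<close> at \<open>j + 1\<close> is reached
  from the frame of \<open>V\<close> at \<open>j\<close> by shifting and then changing lifts, or in
  the other order. The invertible frame cancels.\<close>

lemma gauge_relation_at_1:
  fixes V V' :: "int \<Rightarrow> complex^4"
  assumes V: "\<And>j. V (j+4) = a j *s V (j+3) + b j *s V (j+2) + c j *s V (j+1) - V j"
    and V': "\<And>j. V' (j+4) = a' j *s V' (j+3) + b' j *s V' (j+2) + c' j *s V' (j+1) - V' j"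
    and r: "\<And>j. V' j = r j *s (a (j-2) *s V (j+1) + c (j-2) *s V (j-1))"
    and det: "det (vector [V j, V (j+1), V (j+2), V (j+3)] :: complex^4^4) \<noteq> 0"
  shows "lax_inverse_matrix (a j) (b j) (c j) 1 ** gauge_inverse 1 a b c r (j+1) =
    gauge_inverse 1 a b c r j ** lax_inverse_matrix (a' j) (b' j) (c' j) 1"
proof -
  let ?F = "vector [V j, V (j+1), V (j+2), V (j+3)] :: complex^4^4"
  let ?F' = "vector [V' j, V' (j+1), V' (j+2), V' (j+3)] :: complex^4^4"
  let ?Q = "transpose (gauge_inverse 1 a b c r j)"
  let ?Q1 = "transpose (gauge_inverse 1 a b c r (j+1))"
  let ?N = "transpose (lax_inverse_matrix (a j) (b j) (c j) 1)"
  let ?N' = "transpose (lax_inverse_matrix (a' j) (b' j) (c' j) 1)"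
  have "?Q1 ** (?N ** ?F) = ?N' ** (?Q ** ?F)"
    using frame_recurrence[OF V, of j] frame_recurrence[OF V', of j]
      frame_gauge_inverse[OF V r, of j] frame_gauge_inverse[OF V r, of "j+1"]
    by (simp add: algebra_simps)
  then have eq: "(?Q1 ** (?N ** ?F)) ** G = (?N' ** (?Q ** ?F)) ** G" for G :: "complex^4^4"
    by simp
  obtain G where "?F ** G = mat 1"
    using det unfolding invertible_det_nz[symmetric] invertible_def by blast
  with eq[of G] have "?Q1 ** ?N = ?N' ** ?Q"
    by (simp only: matrix_mul_assoc[symmetric] matrix_mul_rid)
  then have "transpose (?Q1 ** ?N) = transpose (?N' ** ?Q)"
    by simp
  then show ?thesis
    by (simp add: matrix_transpose_mul transpose_transpose)
qed

text \<open>
  Only the last column is not an identity in \<open>a, b, c, r\<close>. Its rows 1 and 3 form a linear system in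
  \<open>X\<close> and \<open>Y\<close> whose determinant \<open>?\<alpha>\<close> is a factor of the determinant of the gauge matrix; once
  \<open>X = Y = 0\<close>, each row is homogeneous in \<open>\<mu>\<close>.
\<close>

lemma gauge_relation:
  assumes rel: "lax_inverse_matrix (a j) (b j) (c j) 1 ** gauge_inverse 1 a b c r (j+1) =
      gauge_inverse 1 a b c r j ** lax_inverse_matrix (a' j) (b' j) (c' j) 1"
    and det: "det (gauge_inverse 1 a b c r j) \<noteq> 0"
    and z: "z \<noteq> 0"
  shows "lax_inverse_matrix (a j) (b j) (c j) z ** gauge_inverse (1/z) a b c r (j+1) =
      gauge_inverse (1/z) a b c r j ** lax_inverse_matrix (a' j) (b' j) (c' j) z"
proof -
  have idx: "j + 1 - 2 = j - 1" "j + 1 - 1 = j" "j + 1 + 1 = j + 2" "j + 1 + 2 = j + 3" "j + 1 + 3 = j + 4"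
    by simp_all
  note matrix_defs = vec_eq_iff forall_4 matrix_matrix_mult_def sum_4 lax_inverse_matrix_def
    gauge_inverse_def idx vector_4 vec_lambda_beta
  note eqs = rel[unfolded matrix_defs, simplified]
  define X where "X = c' j * r (j+1) - c (j-2) * r j"
  define Y where "Y = a' j * r (j+3) - a (j+2) * r (j+4)"
  let ?\<alpha> = "c (j-1) * (c (j+1) + a (j+1) * b j) + a (j-1) * a (j+1)"
  have "?\<alpha> \<noteq> 0"
    using det by (auto simp: det_gauge_inverse)
  have 1: "c (j-1) * X = a (j+1) * Y"
    using eqs unfolding X_def Y_def by (simp add: algebra_simps)
  have 2: "a (j-1) * X + (c (j+1) + a (j+1) * b j) * Y = 0"
    using eqs unfolding X_def Y_def by (simp add: algebra_simps)
  have "?\<alpha> * X = 0" "?\<alpha> * Y = 0"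
    using 1 2 by algebra+
  then have "X = 0" "Y = 0"
    using \<open>?\<alpha> \<noteq> 0\<close> by auto
  then have c': "c' j * r (j+1) = c (j-2) * r j" and a': "a' j * r (j+3) = a (j+2) * r (j+4)"
    by (auto simp: X_def Y_def)
  define \<mu> where "\<mu> = 1 / z"
  have \<mu>: "z * \<mu> = 1"
    using z by (simp add: \<mu>_def)
  have \<mu>': "\<mu> * z = 1"
    using \<mu> by (simp add: mult.commute)
  \<comment> \<open>In rows 2 and 4 of the last column, exactly the terms with
    \<open>a (j+1)\<close> keep a factor \<mu> in the general relation. They cancel by
    \<open>a'\<close>, leaving identities free of \<mu>.\<close>
  have row2: "c j * r (j+2) * b' j - (a (j-2) + c (j-2) * b (j-1)) * r j = - a (j+2) * r (j+4)"
  proof -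
    have "c j * (a (j+2) * a (j+1) * r (j+4)) - a (j+2) * r (j+4) =
        c j * r (j+2) * b' j - (a (j-2) + c (j-2) * b (j-1)) * r j
        + a (j+1) * c j * r (j+3) * a' j"
      using eqs by blast
    with a' show ?thesis by algebra
  qed
  have row4: "c (j-2) * r j + a j * r (j+2) * b' j = (c (j+2) + a (j+2) * b (j+1)) * r (j+4)"
  proof -
    have "(c (j+2) + a (j+2) * b (j+1)) * r (j+4) + a j * (a (j+2) * a (j+1) * r (j+4)) =
        c (j-2) * r j + a j * r (j+2) * b' j + a (j+1) * a j * r (j+3) * a' j"
      using eqs by blast
    with a' show ?thesis by algebra
  qed
  show ?thesis
    unfolding matrix_defs \<mu>_def[symmetric]
    by (simp add: \<mu> \<mu>', intro conjI; use \<mu> a' c' row2 row4 in algebra)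
qed

section \<open>Zero curvature for one step and along the orbit\<close>

text \<open>A single step, phrased at time 0 so that it applies with any iterate as the initial
  polygon.\<close>

lemma pentagram_step_zero_curvature:
  assumes n: "odd n" and \<phi>: "twisted_polygon n M \<phi>" and T: "pentagram_defined \<phi>"
  obtains P :: "int \<Rightarrow> complex \<Rightarrow> complex^4^4" where
    "\<And>j z. z \<noteq> 0 \<Longrightarrow> invertible (P j z)"
    "\<And>j z. P (j + int n) z = P j z"
    "\<And>j z. z \<noteq> 0 \<Longrightarrow> lax n M (pentagram \<phi>) j 0 z
        = P (j+1) z ** lax n M \<phi> j 0 z ** matrix_inv (P j z)"
proof -
  obtain V where V: "normalized_lift n M \<phi> V"
    using exists_normalized_lift[OF n \<phi>] by blast
  obtain a b c where abc: "are_coordinates n M \<phi> a b c"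
    and rec: "\<And>j. V (j+4) = a j *s V (j+3) + b j *s V (j+2) + c j *s V (j+1) - V j"
    using normalized_lift_recurrence[OF V] by blast
  obtain V' where V': "normalized_lift n M (pentagram \<phi>) V'"
    using exists_normalized_lift[OF n twisted_polygon_pentagram[OF \<phi> T]] by blast
  obtain a' b' c' where abc': "are_coordinates n M (pentagram \<phi>) a' b' c'"
    and rec': "\<And>j. V' (j+4) = a' j *s V' (j+3) + b' j *s V' (j+2) + c' j *s V' (j+1) - V' j"
    using normalized_lift_recurrence[OF V'] by blast
  have span: "vec.span {V j} = \<phi> j" and span': "vec.span {V' j} = pentagram \<phi> j"
    and det: "det (vector [V j, V (j+1), V (j+2), V (j+3)] :: complex^4^4) = 1"
    and det': "det (vector [V' j, V' (j+1), V' (j+2), V' (j+3)] :: complex^4^4) = 1"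
    and per: "V (j + int n) = M *v V j" "V' (j + int n) = M *v V' j" for j
    using V V' by (auto simp: normalized_lift_def)
  have per_abc: "a (j + int n) = a j" "b (j + int n) = b j" "c (j + int n) = c j" for j
    using abc by (auto simp: are_coordinates_def)
  define W where "W k = a (k-2) *s V (k+1) + c (k-2) *s V (k-1)" for k
  have W0: "W k \<noteq> 0" and W: "pentagram \<phi> k = vec.span {W k}" for k
    using pentagram_eq_span[OF span rec T] by (simp_all add: W_def)
  have "\<exists>r. V' j = r *s W j" for j
    using vec.span_base[of "V' j" "{V' j}"] unfolding span' W by (auto simp: vec.span_singleton)
  then obtain r where r: "\<And>j. V' j = r j *s W j"
    by metis
  have per_r: "r (j + int n) = r j" for j
  proof -
    have "a (j + int n - 2) = a (j - 2)" "c (j + int n - 2) = c (j - 2)"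
      "V (j + int n + 1) = M *v V (j + 1)" "V (j + int n - 1) = M *v V (j - 1)"
      using per_abc(1,3)[of "j - 2"] per(1)[of "j + 1"] per(1)[of "j - 1"]
      by (simp_all add: algebra_simps)
    \<comment> \<open>\<open>W\<close> is twisted by \<open>M\<close> exactly as \<open>V'\<close>
      is, so their ratio \<open>r\<close> is periodic.\<close>
    then have WM: "W (j + int n) = M *v W j"
      by (simp add: W_def vec.add vec.scale)
    have "r (j + int n) *s W (j + int n) = r j *s W (j + int n)"
      using per(2)[of j] unfolding r WM by (simp add: vec.scale)
    then show ?thesis
      using W0 vec.scale_right_imp_eq by blast
  qed
  define Q where "Q j z = gauge_inverse (1/z) a b c r j" for j z
  have V'_eq: "V' j = r j *s (a (j-2) *s V (j+1) + c (j-2) *s V (j-1))" for j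
    by (simp add: r W_def)
  \<comment> \<open>At parameter 1 this is the change of basis between two frames of determinant
    1.\<close>
  have det_Q1: "det (gauge_inverse 1 a b c r j) = 1" for j
    using arg_cong[OF frame_gauge_inverse[OF rec V'_eq, of j], of det]
    by (simp add: det_mul det det')
  have inv_Q: "invertible (Q j z)" if "z \<noteq> 0" for j z
  proof -
    have "det (Q j z) = (1/z)\<^sup>2 * det (gauge_inverse 1 a b c r j)"
      by (simp add: Q_def det_gauge_inverse)
    then show ?thesis
      using that by (simp add: invertible_det_nz det_Q1)
  qed
  have per_Q: "Q (j + int n) z = Q j z" for j z
  proof -
    have "j + int n + i = j + i + int n" "j + int n - i = j - i + int n" for i
      by simp_all
    then show ?thesis
      by (simp only: Q_def gauge_inverse_def per_abc per_r)
  qed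
  have rel: "lax_inverse_matrix (a j) (b j) (c j) z ** Q (j+1) z =
      Q j z ** lax_inverse_matrix (a' j) (b' j) (c' j) z" if "z \<noteq> 0" for j z
    unfolding Q_def
    by (rule gauge_relation[OF gauge_relation_at_1[OF rec rec' V'_eq]])
      (simp_all add: det det_Q1 that)
  have lax: "lax n M \<phi> j 0 = lax_matrix (a j) (b j) (c j)"
    "lax n M (pentagram \<phi>) j 0 = lax_matrix (a' j) (b' j) (c' j)" for j
    by (simp_all add: lax_def Let_def coord_a_def coord_b_def coord_c_def
        coordinates_eqI[OF n abc] coordinates_eqI[OF n abc'])
  show thesis
  \<comment> \<open>\<open>Q\<close> intertwines the inverse Lax matrices; inverting the relation
    puts \<open>Q (j+1) z\<close> on the left as an inverse, so the gauge is the inverse of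
    \<open>Q\<close>.\<close>
  proof (rule that[of "\<lambda>j z. matrix_inv (Q j z)"])
    fix j :: int and z :: complex
    show "matrix_inv (Q (j + int n) z) = matrix_inv (Q j z)"
      by (simp add: per_Q)
    assume z: "z \<noteq> 0"
    show "invertible (matrix_inv (Q j z))"
      by (rule matrix_inv_invertible(3)[OF inv_Q[OF z]])
    let ?L = "lax_matrix (a j) (b j) (c j) z" and ?L' = "lax_matrix (a' j) (b' j) (c' j) z"
    let ?K = "lax_inverse_matrix (a j) (b j) (c j) z"
    let ?K' = "lax_inverse_matrix (a' j) (b' j) (c' j) z"
    have LK: "?L ** ?K = mat 1" and KL': "?K' ** ?L' = mat 1"
      using lax_inverse_mult_lax[OF z] matrix_left_right_inverse by blast+
    have "?L' = matrix_inv (Q (j+1) z) ** (?L ** ?K) ** Q (j+1) z ** ?L'"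
      by (simp add: LK matrix_inv_invertible(2)[OF inv_Q[OF z]])
    also have "\<dots> = matrix_inv (Q (j+1) z) ** ?L ** (?K ** Q (j+1) z) ** ?L'"
      by (simp only: matrix_mul_assoc)
    also have "\<dots> = matrix_inv (Q (j+1) z) ** ?L ** Q j z ** (?K' ** ?L')"
      by (simp only: rel[OF z] matrix_mul_assoc)
    also have "\<dots> = matrix_inv (Q (j+1) z) ** ?L ** Q j z"
      by (simp add: KL')
    finally show "lax n M (pentagram \<phi>) j 0 z
        = matrix_inv (Q (j+1) z) ** lax n M \<phi> j 0 z ** matrix_inv (matrix_inv (Q j z))"
      by (simp only: lax matrix_inv_invertible(4)[OF inv_Q[OF z]])
  qed
qed

theorem theorem1p3:
  fixes n :: nat and M :: "complex^4^4" and \<phi> :: "int \<Rightarrow> (complex^4) set"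
  assumes "odd n"
    and "twisted_polygon n M \<phi>"
  shows "(\<forall>a b c z :: complex. z \<noteq> 0 \<longrightarrow>
            invertible (lax_inverse_matrix a b c z) \<and>
            lax_matrix a b c z = matrix_inv (lax_inverse_matrix a b c z)) \<and>
         (\<exists>P :: int \<Rightarrow> nat \<Rightarrow> complex \<Rightarrow> complex^4^4.
            \<forall>t. pentagram_iterate_defined (Suc t) \<phi> \<longrightarrow>
              (\<forall>j z. z \<noteq> 0 \<longrightarrow>
                 invertible (P j t z) \<and>
                 P (j + int n) t z = P j t z \<and>
                 lax n M \<phi> j (Suc t) z = P (j + 1) t z ** lax n M \<phi> j t z ** matrix_inv (P j t z)))"
proof (intro conjI allI impI)
  fix a b c z :: complex
  assume "z \<noteq> 0"
  note KL = lax_inverse_mult_lax[OF this, of a b c]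
  then show "invertible (lax_inverse_matrix a b c z)"
    unfolding invertible_right_inverse by blast
  show "lax_matrix a b c z = matrix_inv (lax_inverse_matrix a b c z)"
    using matrix_inv_eqI[OF KL] by simp
next
  have lax_iterate: "lax n M ((pentagram ^^ t) \<phi>) j 0 = lax n M \<phi> j t" for j t
    by (simp add: lax_def)
  \<comment> \<open>Each time has its own gauge, and the claim is vacuous once an iterate is
    undefined; the gauges are then collected by choice.\<close>
  have "\<exists>R :: int \<Rightarrow> complex \<Rightarrow> complex^4^4. pentagram_iterate_defined (Suc t) \<phi> \<longrightarrow>
      (\<forall>j z. z \<noteq> 0 \<longrightarrow> invertible (R j z) \<and> R (j + int n) z = R j z \<and>
        lax n M \<phi> j (Suc t) z = R (j + 1) z ** lax n M \<phi> j t z ** matrix_inv (R j z))" for t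
  proof (cases "pentagram_iterate_defined (Suc t) \<phi>")
    case True
    \<comment> \<open>Definedness up to \<open>Suc t\<close> supplies both the first
      \<open>t\<close> steps, which make the iterate a twisted polygon, and the step from time
      \<open>t\<close> itself.\<close>
    then have "twisted_polygon n M ((pentagram ^^ t) \<phi>)" "pentagram_defined ((pentagram ^^ t) \<phi>)"
      using twisted_polygon_iterate[OF assms(2), of t] by (auto simp: pentagram_iterate_defined_def)
    from pentagram_step_zero_curvature[OF assms(1) this] obtain R :: "int \<Rightarrow> complex \<Rightarrow> complex^4^4"
      where R: "\<And>j z. z \<noteq> 0 \<Longrightarrow> invertible (R j z)"
      "\<And>j z. R (j + int n) z = R j z"
      "\<And>j z. z \<noteq> 0 \<Longrightarrow> lax n M (pentagram ((pentagram ^^ t) \<phi>)) j 0 z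
        = R (j+1) z ** lax n M ((pentagram ^^ t) \<phi>) j 0 z ** matrix_inv (R j z)"
      by metis
    have "lax n M (pentagram ((pentagram ^^ t) \<phi>)) j 0 = lax n M \<phi> j (Suc t)" for j
      using lax_iterate[of "Suc t" j] by simp
    with R show ?thesis
      unfolding lax_iterate by (intro exI[of _ R]) simp
  qed simp
  then obtain R :: "nat \<Rightarrow> int \<Rightarrow> complex \<Rightarrow> complex^4^4" where
    R: "\<And>t. pentagram_iterate_defined (Suc t) \<phi> \<longrightarrow>
      (\<forall>j z. z \<noteq> 0 \<longrightarrow> invertible (R t j z) \<and> R t (j + int n) z = R t j z \<and>
        lax n M \<phi> j (Suc t) z = R t (j + 1) z ** lax n M \<phi> j t z ** matrix_inv (R t j z))"
    by metis
  show "\<exists>P :: int \<Rightarrow> nat \<Rightarrow> complex \<Rightarrow> complex^4^4.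
      \<forall>t. pentagram_iterate_defined (Suc t) \<phi> \<longrightarrow>
        (\<forall>j z. z \<noteq> 0 \<longrightarrow>
           invertible (P j t z) \<and>
           P (j + int n) t z = P j t z \<and>
           lax n M \<phi> j (Suc t) z = P (j + 1) t z ** lax n M \<phi> j t z ** matrix_inv (P j t z))"
    by (rule exI[of _ "\<lambda>j t. R t j"]) (use R in blast)
qed

end
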